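(* Let $T,K,r,\sigma>0$ and $h(x)=(K-e^x)^+$, and let $u^\lambda$ ($\lambda>0$) and $u^*$ be the functions described in the context. Let $C$ be the constant, independent of $\lambda$, for which $u^\lambda(x,t)\ge h(x)-\lambda\log\frac{CrK}{\lambda}$ for all $\lambda>0$ and $(x,t)\in\mathbb R\times[0,T]$ (the existence of such a constant is a preceding lemma of the paper). Then, for every $\lambda>0$ and all $(x,t)\in\mathbb R\times[0,T]$, $$u^{\lambda}(x,t)-\lambda\log\big(1+(T-t)\big)\ \le\ u^*(x,t)\ \le\ u^{\lambda}(x,t)+\lambda\log\frac{CrK}{\lambda}.$$
   Context: Here $r$ is the risk-free rate, $\sigma$ the volatility of the stock, $K$ the strike and $T$ the maturity of an American put option. Let $\mathcal L_x=\frac12\sigma^2\partial_{xx}+(r-\frac12\sigma^2)\partial_x-r$. For each $\lambda>0$, $u^\lambda$ is the unique classical solution, belonging to $C^{2+\alpha,1+\alpha/2}_{loc}(\mathbb R\times[0,T))\cap C(\mathbb R\times[0,T])$ for any $0<\alpha<1$ and satisfying $0\le u^\lambda(x,t)\le K+\lambda(T-t)$, of $$\partial_tu^\lambda+\mathcal L_xu^\lambda+\lambda\exp\Big(-\frac{u^\lambda-h}{\lambda}\Big)=0,\qquad u^\lambda(x,T)=h(x).$$ The function $u^*$ is the solution of the variational inequality $$\min\{-\partial_tu^*-\mathcal L_xu^*,\ u^*(x,t)-h(x)\}=0,\qquad u^*(x,T)=h(x);$$ $u^*(\log S,t)$ is the price at time $t$, when the stock price is $S$, of the American put with strike $K$ and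 maturity $T$, where under the risk-neutral measure the stock follows $dS_t=S_t(r\,dt+\sigma\,dW_t)$ with $W$ a standard Brownian motion. By the paper's convention, constants denoted $C$ in general depend on the model coefficients $r,\sigma,K$.
   Formalization: At t=T the bound defining C forces λ ≤ CrK, so no C serves all λ>0; the formal statement takes any set of λ>0 on which one C>0 works and claims the upper bound for λ in that set, while the lower bound is kept for all λ>0. *)

theory Defs
  imports "HOL-Probability.Probability"
begin

section \<open>Payoff and operator\<close>

definition put_payoff :: "real \<Rightarrow> real \<Rightarrow> real" where
  "put_payoff K x = max 0 (K - exp x)"

text \<open>The operator \<open>L = 1/2 \<sigma>^2 d_xx + (r - 1/2 \<sigma>^2) d_x - r\<close>, acting on the value \<open>v\<close> and the
  spatial derivatives \<open>vx\<close>, \<open>vxx\<close> of a function at a point.\<close>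

definition bs_op :: "real \<Rightarrow> real \<Rightarrow> real \<Rightarrow> real \<Rightarrow> real \<Rightarrow> real" where
  "bs_op r \<sigma> v vx vxx = 1/2 * \<sigma>\<^sup>2 * vxx + (r - 1/2 * \<sigma>\<^sup>2) * vx - r * v"


section \<open>Parabolic function spaces\<close>

text \<open>\<open>v\<close> is of class \<open>C^{2,1}\<close> on \<open>\<real> \<times> I\<close>, with derivatives \<open>vt\<close>, \<open>vx\<close>, \<open>vxx\<close>.
  Time derivatives are relative to \<open>I\<close>, hence one-sided at an end point belonging to \<open>I\<close>.\<close>

definition C21_on ::
  "real set \<Rightarrow> (real \<Rightarrow> real \<Rightarrow> real) \<Rightarrow> (real \<Rightarrow> real \<Rightarrow> real) \<Rightarrow> (real \<Rightarrow> real \<Rightarrow> real) \<Rightarrow>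
    (real \<Rightarrow> real \<Rightarrow> real) \<Rightarrow> bool" where
  "C21_on I v vt vx vxx \<longleftrightarrow>
     (\<forall>x. \<forall>t\<in>I.
        ((\<lambda>s. v x s) has_real_derivative vt x t) (at t within I) \<and>
        ((\<lambda>y. v y t) has_real_derivative vx x t) (at x) \<and>
        ((\<lambda>y. vx y t) has_real_derivative vxx x t) (at x)) \<and>
     continuous_on (UNIV \<times> I) (\<lambda>(x, t). v x t) \<and>
     continuous_on (UNIV \<times> I) (\<lambda>(x, t). vt x t) \<and>
     continuous_on (UNIV \<times> I) (\<lambda>(x, t). vx x t) \<and>
     continuous_on (UNIV \<times> I) (\<lambda>(x, t). vxx x t)"

definition parabolic_hoelder_on :: "real \<Rightarrow> (real \<times> real) set \<Rightarrow> (real \<Rightarrow> real \<Rightarrow> real) \<Rightarrow> bool" where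
  "parabolic_hoelder_on \<alpha> Q f \<longleftrightarrow>
     (\<exists>M. \<forall>(x, t)\<in>Q. \<forall>(y, s)\<in>Q. \<bar>f x t - f y s\<bar> \<le> M * (\<bar>x - y\<bar> + sqrt \<bar>t - s\<bar>) powr \<alpha>)"

definition time_hoelder_on :: "real \<Rightarrow> (real \<times> real) set \<Rightarrow> (real \<Rightarrow> real \<Rightarrow> real) \<Rightarrow> bool" where
  "time_hoelder_on \<beta> Q f \<longleftrightarrow>
     (\<exists>M. \<forall>x t s. (x, t) \<in> Q \<longrightarrow> (x, s) \<in> Q \<longrightarrow> \<bar>f x t - f x s\<bar> \<le> M * \<bar>t - s\<bar> powr \<beta>)"

text \<open>The class \<open>C^{2+\<alpha>,1+\<alpha>/2}_loc(\<real> \<times> [0,T))\<close>, \<open>0 < \<alpha> < 1\<close>. On every compact subset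
  the seminorms of the usual parabolic Hoelder space are finite: the top-order derivatives \<open>vt\<close>, \<open>vxx\<close>
  are Hoelder of exponent \<open>\<alpha>\<close> in \<open>x\<close> and \<open>\<alpha>/2\<close> in \<open>t\<close>, and \<open>vx\<close> is Hoelder of exponent
  \<open>(1+\<alpha>)/2\<close> in \<open>t\<close>.\<close>

definition C2a_loc ::
  "real \<Rightarrow> real \<Rightarrow> (real \<Rightarrow> real \<Rightarrow> real) \<Rightarrow> (real \<Rightarrow> real \<Rightarrow> real) \<Rightarrow> (real \<Rightarrow> real \<Rightarrow> real) \<Rightarrow>
    (real \<Rightarrow> real \<Rightarrow> real) \<Rightarrow> bool" where
  "C2a_loc T \<alpha> v vt vx vxx \<longleftrightarrow>
     C21_on {0..<T} v vt vx vxx \<and>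
     (\<forall>Q. compact Q \<longrightarrow> Q \<subseteq> UNIV \<times> {0..<T} \<longrightarrow>
        parabolic_hoelder_on \<alpha> Q vt \<and> parabolic_hoelder_on \<alpha> Q vxx \<and>
        time_hoelder_on ((1 + \<alpha>) / 2) Q vx)"


section \<open>The penalised equation\<close>

definition penalised_solution ::
  "real \<Rightarrow> real \<Rightarrow> real \<Rightarrow> real \<Rightarrow> real \<Rightarrow> (real \<Rightarrow> real \<Rightarrow> real) \<Rightarrow> bool" where
  "penalised_solution r \<sigma> K T lam v \<longleftrightarrow>
     (\<exists>vt vx vxx.
        (\<forall>\<alpha>. 0 < \<alpha> \<longrightarrow> \<alpha> < 1 \<longrightarrow> C2a_loc T \<alpha> v vt vx vxx) \<and>
        (\<forall>x. \<forall>t\<in>{0..<T}.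
           vt x t + bs_op r \<sigma> (v x t) (vx x t) (vxx x t)
             + lam * exp (- (v x t - put_payoff K x) / lam) = 0)) \<and>
     continuous_on (UNIV \<times> {0..T}) (\<lambda>(x, t). v x t) \<and>
     (\<forall>x. v x T = put_payoff K x) \<and>
     (\<forall>x. \<forall>t\<in>{0..T}. 0 \<le> v x t \<and> v x t \<le> K + lam * (T - t))"


section \<open>The variational inequality\<close>

text \<open>The solution of the obstacle problem is not \<open>C^{2,1}\<close> across the free boundary, so
  \<open>min (- d_t v - L v) (v - h) = 0\<close> is read in the viscosity sense: the derivatives of \<open>v\<close> are replaced by
  those of \<open>C^{2,1}\<close> functions touching \<open>v\<close> from above (subsolution) or from below (supersolution).\<close>

definition vi_subsolution ::
  "real \<Rightarrow> real \<Rightarrow> real \<Rightarrow> real \<Rightarrow> (real \<Rightarrow> real \<Rightarrow> real) \<Rightarrow> bool" where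
  "vi_subsolution r \<sigma> K T v \<longleftrightarrow>
     (\<forall>\<phi> \<phi>t \<phi>x \<phi>xx x0 t0.
        C21_on {0<..<T} \<phi> \<phi>t \<phi>x \<phi>xx \<longrightarrow> t0 \<in> {0<..<T} \<longrightarrow> \<phi> x0 t0 = v x0 t0 \<longrightarrow>
        (\<forall>\<^sub>F (x, t) in nhds (x0, t0). v x t \<le> \<phi> x t) \<longrightarrow>
        min (- \<phi>t x0 t0 - bs_op r \<sigma> (\<phi> x0 t0) (\<phi>x x0 t0) (\<phi>xx x0 t0))
            (v x0 t0 - put_payoff K x0) \<le> 0)"

definition vi_supersolution ::
  "real \<Rightarrow> real \<Rightarrow> real \<Rightarrow> real \<Rightarrow> (real \<Rightarrow> real \<Rightarrow> real) \<Rightarrow> bool" where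
  "vi_supersolution r \<sigma> K T v \<longleftrightarrow>
     (\<forall>\<phi> \<phi>t \<phi>x \<phi>xx x0 t0.
        C21_on {0<..<T} \<phi> \<phi>t \<phi>x \<phi>xx \<longrightarrow> t0 \<in> {0<..<T} \<longrightarrow> \<phi> x0 t0 = v x0 t0 \<longrightarrow>
        (\<forall>\<^sub>F (x, t) in nhds (x0, t0). \<phi> x t \<le> v x t) \<longrightarrow>
        min (- \<phi>t x0 t0 - bs_op r \<sigma> (\<phi> x0 t0) (\<phi>x x0 t0) (\<phi>xx x0 t0))
            (v x0 t0 - put_payoff K x0) \<ge> 0)"

definition vi_solution ::
  "real \<Rightarrow> real \<Rightarrow> real \<Rightarrow> real \<Rightarrow> (real \<Rightarrow> real \<Rightarrow> real) \<Rightarrow> bool" where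
  "vi_solution r \<sigma> K T v \<longleftrightarrow>
     continuous_on (UNIV \<times> {0..T}) (\<lambda>(x, t). v x t) \<and>
     vi_subsolution r \<sigma> K T v \<and> vi_supersolution r \<sigma> K T v \<and>
     (\<forall>x. v x T = put_payoff K x)"


section \<open>The American put\<close>

text \<open>Standard Brownian motion on \<open>[0,\<infinity>)\<close> relative to a filtration of \<open>M\<close>. The filtration is
  indexed by \<^typ>\<open>real\<close> to match the library; its members at negative times play no role.\<close>

locale standard_brownian_motion =
  prob_space M + filtration "space M" F
  for M :: "'w measure" and F :: "real \<Rightarrow> 'w measure" and W :: "real \<Rightarrow> 'w \<Rightarrow> real" +
  assumes subalg: "\<And>t. subalgebra M (F t)"
    and adapted: "\<And>t. 0 \<le> t \<Longrightarrow> W t \<in> borel_measurable (F t)"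
    and start: "\<And>\<omega>. \<omega> \<in> space M \<Longrightarrow> W 0 \<omega> = 0"
    and continuous_paths: "\<And>\<omega>. \<omega> \<in> space M \<Longrightarrow> continuous_on {0..} (\<lambda>t. W t \<omega>)"
    and increments_indep: "\<And>s t. 0 \<le> s \<Longrightarrow> s < t \<Longrightarrow>
        indep_set (sets (F s)) (sets (vimage_algebra (space M) (\<lambda>\<omega>. W t \<omega> - W s \<omega>) borel))"
    and increments_normal: "\<And>s t. 0 \<le> s \<Longrightarrow> s < t \<Longrightarrow>
        distributed M lborel (\<lambda>\<omega>. W t \<omega> - W s \<omega>) (normal_density 0 (sqrt (t - s)))"

text \<open>The solution at time \<open>s\<close> of \<open>dS = S (r dt + \<sigma> dW)\<close> started from \<open>S\<close> at time \<open>t\<close>.\<close>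

definition stock_price ::
  "real \<Rightarrow> real \<Rightarrow> (real \<Rightarrow> 'w \<Rightarrow> real) \<Rightarrow> real \<Rightarrow> real \<Rightarrow> real \<Rightarrow> 'w \<Rightarrow> real" where
  "stock_price r \<sigma> W t S s \<omega> = S * exp ((r - 1/2 * \<sigma>\<^sup>2) * (s - t) + \<sigma> * (W s \<omega> - W t \<omega>))"

definition american_put_price ::
  "'w measure \<Rightarrow> (real \<Rightarrow> 'w measure) \<Rightarrow> (real \<Rightarrow> 'w \<Rightarrow> real) \<Rightarrow>
    real \<Rightarrow> real \<Rightarrow> real \<Rightarrow> real \<Rightarrow> real \<Rightarrow> real \<Rightarrow> real" where
  "american_put_price M F W r \<sigma> K T S t =
     (SUP \<tau>\<in>{\<tau>. stopping_time F \<tau> \<and> (\<forall>\<omega>\<in>space M. t \<le> \<tau> \<omega> \<and> \<tau> \<omega> \<le> T)}.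
        (\<integral>\<omega>. exp (- r * (\<tau> \<omega> - t)) * max 0 (K - stock_price r \<sigma> W t S (\<tau> \<omega>) \<omega>) \<partial>M))"

end

theory Submission
  imports Defs
begin

text \<open>
  The price only serves to bound \<open>u\<^sup>*\<close>: discounted payoffs lie in \<open>[0, K]\<close>, hence so does their
  supremum. Everything else is a comparison of the viscosity solution \<open>u\<^sup>*\<close> with classical functions,
  where no doubling of variables is needed: the classical function, shifted and perturbed, is itself
  an admissible test function.

  With \<open>L\<close> the operator of the equation, the perturbation is
  \<open>\<psi> = x\<^sup>2 + B (T - t) + 1/t\<close>, where \<open>B\<close> makes \<open>- \<psi>\<^sub>t - L \<psi> \<ge> 0\<close>; such a \<open>B\<close> exists because
  \<open>r > 0\<close>, so that \<open>- L (x\<^sup>2)\<close> is a quadratic polynomial bounded below. If a bounded continuous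
  \<open>f\<close> with \<open>f \<le> 0\<close> at time \<open>T\<close> is positive somewhere, then \<open>f - \<epsilon> \<psi>\<close> has, for small \<open>\<epsilon> > 0\<close>, a
  positive maximum over \<open>\<real> \<times> (0, T)\<close>, which is attained
  (\<open>perturbed_positive_max\<close>). Applied to \<open>f = u\<^sup>* - w\<close> and to \<open>f = v - u\<^sup>*\<close>, this yields the
  comparison principles \<open>vi_subsolution_le\<close> and \<open>vi_supersolution_ge\<close>.

  For the upper bound, where \<open>\<lambda> \<in> \<Lambda>\<close>, put \<open>w = u\<^sup>\<lambda> + c\<close> with \<open>c = \<lambda> log (C r K / \<lambda>)\<close>.
  The hypothesis on \<open>C\<close> says \<open>w \<ge> h\<close>; at time \<open>T\<close> it gives \<open>c \<ge> 0\<close>, so that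
  \<open>- w\<^sub>t - L w = \<lambda> exp (- (u\<^sup>\<lambda> - h) / \<lambda>) + r c \<ge> 0\<close>.
  For the lower bound put \<open>v = u\<^sup>\<lambda> - \<lambda> log (1 + T - t)\<close>. Where \<open>v > h\<close>, the penalty
  \<open>\<lambda> exp (- (u\<^sup>\<lambda> - h) / \<lambda>)\<close> is less than \<open>\<lambda> / (1 + T - t)\<close>, which is exactly what the time
  derivative of the logarithm contributes, and so \<open>- v\<^sub>t - L v \<le> 0\<close> there.
\<close>


section \<open>Smooth functions and the barrier\<close>

lemma C21_on_subset:
  assumes "C21_on I v vt vx vxx" and "J \<subseteq> I"
  shows "C21_on J v vt vx vxx"
proof -
  have sub: "UNIV \<times> J \<subseteq> UNIV \<times> I"
    using assms(2) by blast
  show ?thesis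
    using assms(1) assms(2) DERIV_subset[OF _ assms(2)] continuous_on_subset[OF _ sub]
    unfolding C21_on_def by blast
qed

lemma C21_on_add:
  assumes "C21_on I v vt vx vxx" and "C21_on I w wt wx wxx"
  shows "C21_on I (\<lambda>x t. v x t + w x t) (\<lambda>x t. vt x t + wt x t) (\<lambda>x t. vx x t + wx x t)
    (\<lambda>x t. vxx x t + wxx x t)"
  using assms unfolding C21_on_def
  by (auto simp: split_beta intro!: DERIV_add continuous_on_add)

lemma C21_on_cmult:
  assumes "C21_on I v vt vx vxx"
  shows "C21_on I (\<lambda>x t. c * v x t) (\<lambda>x t. c * vt x t) (\<lambda>x t. c * vx x t) (\<lambda>x t. c * vxx x t)"
  using assms unfolding C21_on_def
  by (auto simp: split_beta intro!: DERIV_cmult continuous_on_mult_left)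

lemma C21_on_time:
  assumes "\<And>t. t \<in> I \<Longrightarrow> (g has_real_derivative g' t) (at t within I)" and "continuous_on I g'"
  shows "C21_on I (\<lambda>x. g) (\<lambda>x. g') (\<lambda>x t. 0) (\<lambda>x t. 0)"
proof -
  have "continuous_on I g"
    using assms(1) by (rule DERIV_continuous_on)
  then have "continuous_on (UNIV \<times> I) (\<lambda>p::real \<times> real. g (snd p))"
    and "continuous_on (UNIV \<times> I) (\<lambda>p::real \<times> real. g' (snd p))"
    using assms(2)
    by (auto intro!: continuous_on_compose2[of I g] continuous_on_compose2[of I g']
        continuous_intros)
  then show ?thesis
    using assms(1) unfolding C21_on_def by (simp add: split_beta)
qed

lemma C21_on_const: "C21_on I (\<lambda>x t. c) (\<lambda>x t. 0) (\<lambda>x t. 0) (\<lambda>x t. 0)"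
  by (rule C21_on_time) auto

text \<open>The perturbation that confines maxima to a compact set: it is nonnegative, grows at infinity
  in \<open>x\<close> and blows up as \<open>t\<close> decreases to \<open>0\<close>, a time at which the variational inequality is not
  tested. The factor of \<open>T - t\<close> is the maximum over \<open>x\<close> of \<open>L (x\<^sup>2)\<close>.\<close>

definition barrier :: "real \<Rightarrow> real \<Rightarrow> real \<Rightarrow> real \<Rightarrow> real \<Rightarrow> real" where
  "barrier r \<sigma> T x t = x\<^sup>2 + (\<sigma>\<^sup>2 + (2 * r - \<sigma>\<^sup>2)\<^sup>2 / (4 * r)) * (T - t) + 1 / t"

lemma barrier_C21_on:
  assumes "I \<subseteq> {0<..}"
  shows "C21_on I (barrier r \<sigma> T) (\<lambda>x t. - (\<sigma>\<^sup>2 + (2 * r - \<sigma>\<^sup>2)\<^sup>2 / (4 * r)) - 1 / t\<^sup>2)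
    (\<lambda>x t. 2 * x) (\<lambda>x t. 2)"
proof -
  define B where "B = \<sigma>\<^sup>2 + (2 * r - \<sigma>\<^sup>2)\<^sup>2 / (4 * r)"
  have time: "C21_on I (\<lambda>x t. B * (T - t) + 1 / t) (\<lambda>x t. - B - 1 / t\<^sup>2) (\<lambda>x t. 0) (\<lambda>x t. 0)"
    using assms
    by (intro C21_on_time)
      (auto intro!: derivative_eq_intros continuous_intros simp: power2_eq_square field_simps)
  have space: "C21_on I (\<lambda>x t. x\<^sup>2) (\<lambda>x t. 0) (\<lambda>x t. 2 * x) (\<lambda>x t. 2)"
    unfolding C21_on_def split_beta
    by (auto intro!: derivative_eq_intros continuous_intros)
  show ?thesis
    using C21_on_add[OF space time] unfolding barrier_def[abs_def] B_def
    by (simp add: add.assoc)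
qed

lemma barrier_supersolution:
  assumes "0 < r" and "0 < t" and "t \<le> T"
  shows "0 \<le> - (- (\<sigma>\<^sup>2 + (2 * r - \<sigma>\<^sup>2)\<^sup>2 / (4 * r)) - 1 / t\<^sup>2)
    - bs_op r \<sigma> (barrier r \<sigma> T x t) (2 * x) 2"
proof -
  define b where "b = 2 * r - \<sigma>\<^sup>2"
  define B where "B = \<sigma>\<^sup>2 + b\<^sup>2 / (4 * r)"
  have "r * (x - b / (2 * r))\<^sup>2 = r * x\<^sup>2 - b * x + b\<^sup>2 / (4 * r)"
    using assms(1) by (simp add: power2_eq_square field_simps)
  moreover have "0 \<le> r * (x - b / (2 * r))\<^sup>2"
    using assms(1) by simp
  ultimately have "0 \<le> B - \<sigma>\<^sup>2 - b * x + r * x\<^sup>2"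
    unfolding B_def by linarith
  moreover have "0 \<le> B"
    using assms(1) unfolding B_def by simp
  then have "0 \<le> r * (B * (T - t)) + r * (1 / t) + 1 / t\<^sup>2"
    using assms by simp
  moreover have "- (- B - 1 / t\<^sup>2) - bs_op r \<sigma> (barrier r \<sigma> T x t) (2 * x) 2
      = (B - \<sigma>\<^sup>2 - b * x + r * x\<^sup>2) + (r * (B * (T - t)) + r * (1 / t) + 1 / t\<^sup>2)"
    unfolding bs_op_def barrier_def b_def[symmetric] B_def[symmetric]
    by (simp add: b_def algebra_simps)
  ultimately show ?thesis
    unfolding B_def b_def by linarith
qed

lemma barrier_lower_bounds:
  assumes "0 < r" and "0 < t" and "t \<le> T"
  shows "x\<^sup>2 \<le> barrier r \<sigma> T x t" and "1 / t \<le> barrier r \<sigma> T x t"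
proof -
  have "0 \<le> (\<sigma>\<^sup>2 + (2 * r - \<sigma>\<^sup>2)\<^sup>2 / (4 * r)) * (T - t)"
    using assms by simp
  moreover have "0 < 1 / t" and "0 \<le> x\<^sup>2"
    using assms by simp_all
  ultimately show "x\<^sup>2 \<le> barrier r \<sigma> T x t" and "1 / t \<le> barrier r \<sigma> T x t"
    unfolding barrier_def by linarith+
qed


section \<open>Comparison with smooth functions\<close>

lemma perturbed_positive_max:
  fixes f :: "real \<Rightarrow> real \<Rightarrow> real"
  assumes "0 < r" and "0 < T"
    and cont: "continuous_on (UNIV \<times> {0..T}) (\<lambda>(x, t). f x t)"
    and bound: "\<And>x t. t \<in> {0..T} \<Longrightarrow> f x t \<le> b"
    and terminal: "\<And>x. f x T \<le> 0"
    and "t1 \<in> {0..T}" and pos: "0 < f x1 t1"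
  obtains \<epsilon> x0 t0 where "0 < \<epsilon>" and "t0 \<in> {0<..<T}"
    and "0 < f x0 t0 - \<epsilon> * barrier r \<sigma> T x0 t0"
    and "\<And>x t. t \<in> {0<..<T} \<Longrightarrow>
      f x t - \<epsilon> * barrier r \<sigma> T x t \<le> f x0 t0 - \<epsilon> * barrier r \<sigma> T x0 t0"
proof -
  \<comment> \<open>By continuity the positive value may be taken at a positive time; at time \<open>0\<close> the term \<open>1 / t\<close>
    of the barrier has the meaningless value \<open>1 / 0 = 0\<close>.\<close>
  obtain t2 where t2: "t2 \<in> {0<..T}" "0 < f x1 t2"
  proof (cases "t1 = 0")
    case True
    have "continuous_on {0..T} (\<lambda>t. f x1 t)"
      using continuous_on_compose2[OF cont, of "{0..T}" "\<lambda>t. (x1, t)"]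
      by (simp add: continuous_on_Pair image_subset_iff)
    then have "(f x1 \<longlongrightarrow> f x1 0) (at 0 within {0..T})"
      using \<open>0 < T\<close> by (auto simp: continuous_on_def)
    then have "\<forall>\<^sub>F t in at 0 within {0..T}. 0 < f x1 t"
      using pos True by (auto intro: order_tendstoD)
    then have "\<forall>\<^sub>F t in at_right 0. 0 < f x1 t"
      using \<open>0 < T\<close> at_within_Icc_at_right[of 0 T] by simp
    moreover have "\<forall>\<^sub>F t in at_right 0. t \<in> {0<..<T}"
      using \<open>0 < T\<close> by (rule eventually_at_right_real)
    ultimately have "\<forall>\<^sub>F t in at_right 0. 0 < f x1 t \<and> t \<in> {0<..<T}"
      by (rule eventually_conj)
    then obtain t where "0 < f x1 t" "t \<in> {0<..<T}"
      using eventually_happens trivial_limit_at_right_real by blast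
    then show ?thesis
      using that[of t] by simp
  next
    case False
    then show ?thesis
      using that[of t1] assms(6) pos by simp
  qed
  have b: "0 < b"
    using bound[of t2 x1] t2 by auto
  have psi_pos: "0 < barrier r \<sigma> T x t" if "t \<in> {0<..T}" for x t
    using that by (intro less_le_trans[OF _ barrier_lower_bounds(2)[OF \<open>0 < r\<close>]]) auto
  \<comment> \<open>The perturbation takes away half of the positive value found.\<close>
  define \<epsilon> where "\<epsilon> = f x1 t2 / (2 * barrier r \<sigma> T x1 t2)"
  have eps: "0 < \<epsilon>"
    unfolding \<epsilon>_def using psi_pos t2 by simp
  define g where "g x t = f x t - \<epsilon> * barrier r \<sigma> T x t" for x t
  have g_pos: "0 < g x1 t2"
    using psi_pos[OF t2(1), of x1] t2(2) unfolding g_def \<epsilon>_def by simp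
  define R where "R = b / \<epsilon> + 1"
  define Q where "Q = {-R..R} \<times> {\<epsilon> / b..T}"
  \<comment> \<open>Positive values of \<open>g\<close> force \<open>\<epsilon> x\<^sup>2 < b\<close> and \<open>\<epsilon> / t < b\<close>.\<close>
  have confined: "(x, t) \<in> Q" if t: "t \<in> {0<..T}" and "0 < g x t" for x t
  proof -
    have less: "\<epsilon> * barrier r \<sigma> T x t < b"
      using bound[of t x] that unfolding g_def by simp
    have "\<epsilon> * x\<^sup>2 \<le> \<epsilon> * barrier r \<sigma> T x t" and "\<epsilon> * (1 / t) \<le> \<epsilon> * barrier r \<sigma> T x t"
      using t eps by (intro mult_left_mono barrier_lower_bounds \<open>0 < r\<close>; simp)+
    with less have "\<epsilon> * x\<^sup>2 < b" and "\<epsilon> * (1 / t) < b"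
      by linarith+
    then have sq: "x\<^sup>2 < b / \<epsilon>" and time: "\<epsilon> / b < t"
      using eps b t by (simp_all add: field_simps)
    have "0 < b / \<epsilon>"
      using eps b by simp
    then have "b / \<epsilon> \<le> R\<^sup>2"
      using self_le_power[of R 2] unfolding R_def by simp
    with sq have "x\<^sup>2 \<le> R\<^sup>2"
      by linarith
    then have "\<bar>x\<bar> \<le> R"
      using power2_le_imp_le[of "\<bar>x\<bar>" R] \<open>0 < b / \<epsilon>\<close> unfolding R_def by simp
    then show ?thesis
      unfolding Q_def using time t by auto
  qed
  have Q_sub: "Q \<subseteq> UNIV \<times> {0<..T}"
    unfolding Q_def using divide_pos_pos[OF eps b] by auto
  have "continuous_on Q (\<lambda>(x, t). f x t)"
    using Q_sub by (intro continuous_on_subset[OF cont]) auto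
  moreover have "{0<..T} \<subseteq> {0<..}"
    by auto
  then have "continuous_on (UNIV \<times> {0<..T}) (\<lambda>(x, t). barrier r \<sigma> T x t)"
    using barrier_C21_on[of "{0<..T}" r \<sigma> T] unfolding C21_on_def by blast
  then have "continuous_on Q (\<lambda>(x, t). barrier r \<sigma> T x t)"
    using Q_sub by (rule continuous_on_subset)
  ultimately have "continuous_on Q (\<lambda>(x, t). g x t)"
    unfolding g_def split_beta by (intro continuous_intros)
  moreover have "compact Q"
    unfolding Q_def by (intro compact_Times compact_Icc)
  moreover have "(x1, t2) \<in> Q"
    using confined t2(1) g_pos by simp
  moreover from this have "Q \<noteq> {}"
    by blast
  ultimately obtain p where p: "p \<in> Q" "\<forall>q\<in>Q. (\<lambda>(x, t). g x t) q \<le> (\<lambda>(x, t). g x t) p"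
    using continuous_attains_sup[of Q "\<lambda>(x, t). g x t"] by blast
  obtain x0 t0 where p_eq: "p = (x0, t0)"
    by (cases p)
  have Q_le: "g x t \<le> g x0 t0" if "(x, t) \<in> Q" for x t
    using p(2) that unfolding p_eq by auto
  have g0: "0 < g x0 t0"
    using Q_le[OF confined[OF t2(1) g_pos]] g_pos by linarith
  have t0: "t0 \<in> {0<..T}"
    using p Q_sub unfolding p_eq by auto
  have "g x0 T \<le> 0"
    using terminal[of x0] mult_pos_pos[OF eps psi_pos[of T x0]] \<open>0 < T\<close> unfolding g_def by simp
  then have "t0 \<noteq> T"
    using g0 by auto
  have "g x t \<le> g x0 t0" if "t \<in> {0<..<T}" for x t
  proof (cases "0 < g x t")
    case True
    then have "(x, t) \<in> Q"
      using confined that by simp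
    then show ?thesis
      by (rule Q_le)
  next
    case False
    then show ?thesis
      using g0 by simp
  qed
  then show ?thesis
    using that[of \<epsilon> t0 x0] eps t0 \<open>t0 \<noteq> T\<close> g0 unfolding g_def by auto
qed

lemma vi_subsolution_le:
  assumes "0 < r" and "0 < T"
    and sub: "vi_subsolution r \<sigma> K T z"
    and z_cont: "continuous_on (UNIV \<times> {0..T}) (\<lambda>(x, t). z x t)"
    and w_C21: "C21_on {0<..<T} w wt wx wxx"
    and w_cont: "continuous_on (UNIV \<times> {0..T}) (\<lambda>(x, t). w x t)"
    and bound: "\<And>x t. t \<in> {0..T} \<Longrightarrow> z x t - w x t \<le> b"
    and terminal: "\<And>x. z x T \<le> w x T"
    and obstacle: "\<And>x t. t \<in> {0<..<T} \<Longrightarrow> put_payoff K x \<le> w x t"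
    and super: "\<And>x t. t \<in> {0<..<T} \<Longrightarrow>
      0 \<le> - wt x t - bs_op r \<sigma> (w x t) (wx x t) (wxx x t)"
    and "t \<in> {0..T}"
  shows "z x t \<le> w x t"
proof (rule ccontr)
  assume "\<not> z x t \<le> w x t"
  then have pos: "0 < z x t - w x t"
    by simp
  have cont: "continuous_on (UNIV \<times> {0..T}) (\<lambda>(x, t). z x t - w x t)"
    using z_cont w_cont unfolding split_beta by (rule continuous_on_diff)
  have le0: "\<And>x. z x T - w x T \<le> 0"
    using terminal by simp
  obtain \<epsilon> x0 t0 where eps: "0 < \<epsilon>" and t0: "t0 \<in> {0<..<T}"
    and m_pos: "0 < z x0 t0 - w x0 t0 - \<epsilon> * barrier r \<sigma> T x0 t0"
    and max: "\<And>x t. t \<in> {0<..<T} \<Longrightarrow> z x t - w x t - \<epsilon> * barrier r \<sigma> T x t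
      \<le> z x0 t0 - w x0 t0 - \<epsilon> * barrier r \<sigma> T x0 t0"
    by (rule perturbed_positive_max[where f = "\<lambda>x t. z x t - w x t" and \<sigma> = \<sigma>,
        OF assms(1,2) cont bound le0 \<open>t \<in> {0..T}\<close> pos])
      (assumption | (rule that; (assumption | blast)))+
  define m where "m = z x0 t0 - w x0 t0 - \<epsilon> * barrier r \<sigma> T x0 t0"
  define \<psi>t where "\<psi>t = - (\<sigma>\<^sup>2 + (2 * r - \<sigma>\<^sup>2)\<^sup>2 / (4 * r)) - 1 / t0\<^sup>2"
  define \<phi> where "\<phi> x t = w x t + \<epsilon> * barrier r \<sigma> T x t + m" for x t
  have "C21_on {0<..<T} (barrier r \<sigma> T)
      (\<lambda>x t. - (\<sigma>\<^sup>2 + (2 * r - \<sigma>\<^sup>2)\<^sup>2 / (4 * r)) - 1 / t\<^sup>2) (\<lambda>x t. 2 * x) (\<lambda>x t. 2)"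
    by (rule barrier_C21_on) auto
  note phi_C21 =
    C21_on_add[OF C21_on_add[OF w_C21 C21_on_cmult[OF this, of \<epsilon>]] C21_on_const[of _ m],
      folded \<phi>_def]
  have phi_le: "z x t \<le> \<phi> x t" if "t \<in> {0<..<T}" for x t
    using max[OF that, of x] unfolding \<phi>_def m_def by simp
  have "\<forall>\<^sub>F p in nhds (x0, t0). p \<in> UNIV \<times> {0<..<T}"
    using t0 by (intro eventually_nhds_in_open open_Times) auto
  then have touch: "\<forall>\<^sub>F (x, t) in nhds (x0, t0). z x t \<le> \<phi> x t"
    by eventually_elim (auto intro: phi_le)
  have "\<phi> x0 t0 = z x0 t0"
    unfolding \<phi>_def m_def by simp
  then have test: "min (- (wt x0 t0 + \<epsilon> * \<psi>t + 0)
      - bs_op r \<sigma> (\<phi> x0 t0) (wx x0 t0 + \<epsilon> * (2 * x0) + 0) (wxx x0 t0 + \<epsilon> * 2 + 0))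
      (z x0 t0 - put_payoff K x0) \<le> 0"
    using sub[unfolded vi_subsolution_def, rule_format, OF phi_C21 t0 _ touch]
    unfolding \<psi>t_def by simp
  have psi: "0 \<le> - \<psi>t - bs_op r \<sigma> (barrier r \<sigma> T x0 t0) (2 * x0) 2"
    unfolding \<psi>t_def using t0 \<open>0 < r\<close> by (intro barrier_supersolution) auto
  have "- (wt x0 t0 + \<epsilon> * \<psi>t + 0)
      - bs_op r \<sigma> (\<phi> x0 t0) (wx x0 t0 + \<epsilon> * (2 * x0) + 0) (wxx x0 t0 + \<epsilon> * 2 + 0)
    = (- wt x0 t0 - bs_op r \<sigma> (w x0 t0) (wx x0 t0) (wxx x0 t0))
      + \<epsilon> * (- \<psi>t - bs_op r \<sigma> (barrier r \<sigma> T x0 t0) (2 * x0) 2) + r * m"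
    unfolding bs_op_def \<phi>_def by (simp add: algebra_simps)
  also have "\<dots> > 0"
    using super[OF t0, of x0] mult_nonneg_nonneg[OF less_imp_le[OF eps] psi]
      mult_pos_pos[OF \<open>0 < r\<close> m_pos] unfolding m_def by linarith
  finally have "z x0 t0 \<le> put_payoff K x0"
    using test by linarith
  moreover have "0 \<le> \<epsilon> * barrier r \<sigma> T x0 t0"
    using barrier_lower_bounds(1)[of r t0 T x0 \<sigma>] t0 \<open>0 < r\<close> eps
    by (intro mult_nonneg_nonneg) (auto intro: order_trans[OF zero_le_power2])
  ultimately show False
    using obstacle[OF t0, of x0] m_pos by linarith
qed

text \<open>In contrast to the previous lemma, the differential inequality is needed only where
  \<open>v\<close> exceeds the obstacle: a supersolution is never below the obstacle, hence a touching point with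
  \<open>v > z\<close> is such a point.\<close>

lemma vi_supersolution_ge:
  assumes "0 < r" and "0 < T"
    and super: "vi_supersolution r \<sigma> K T z"
    and z_cont: "continuous_on (UNIV \<times> {0..T}) (\<lambda>(x, t). z x t)"
    and v_C21: "C21_on {0<..<T} v vt vx vxx"
    and v_cont: "continuous_on (UNIV \<times> {0..T}) (\<lambda>(x, t). v x t)"
    and bound: "\<And>x t. t \<in> {0..T} \<Longrightarrow> v x t - z x t \<le> b"
    and terminal: "\<And>x. v x T \<le> z x T"
    and sub: "\<And>x t. t \<in> {0<..<T} \<Longrightarrow> put_payoff K x < v x t \<Longrightarrow>
      - vt x t - bs_op r \<sigma> (v x t) (vx x t) (vxx x t) \<le> 0"
    and "t \<in> {0..T}"
  shows "v x t \<le> z x t"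
proof (rule ccontr)
  assume "\<not> v x t \<le> z x t"
  then have pos: "0 < v x t - z x t"
    by simp
  have cont: "continuous_on (UNIV \<times> {0..T}) (\<lambda>(x, t). v x t - z x t)"
    using v_cont z_cont unfolding split_beta by (rule continuous_on_diff)
  have le0: "\<And>x. v x T - z x T \<le> 0"
    using terminal by simp
  obtain \<epsilon> x0 t0 where eps: "0 < \<epsilon>" and t0: "t0 \<in> {0<..<T}"
    and m_pos: "0 < v x0 t0 - z x0 t0 - \<epsilon> * barrier r \<sigma> T x0 t0"
    and max: "\<And>x t. t \<in> {0<..<T} \<Longrightarrow> v x t - z x t - \<epsilon> * barrier r \<sigma> T x t
      \<le> v x0 t0 - z x0 t0 - \<epsilon> * barrier r \<sigma> T x0 t0"
    by (rule perturbed_positive_max[where f = "\<lambda>x t. v x t - z x t" and \<sigma> = \<sigma>,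
        OF assms(1,2) cont bound le0 \<open>t \<in> {0..T}\<close> pos])
      (assumption | (rule that; (assumption | blast)))+
  define m where "m = v x0 t0 - z x0 t0 - \<epsilon> * barrier r \<sigma> T x0 t0"
  define \<psi>t where "\<psi>t = - (\<sigma>\<^sup>2 + (2 * r - \<sigma>\<^sup>2)\<^sup>2 / (4 * r)) - 1 / t0\<^sup>2"
  define \<phi> where "\<phi> x t = v x t + (- \<epsilon>) * barrier r \<sigma> T x t + (- m)" for x t
  have "C21_on {0<..<T} (barrier r \<sigma> T)
      (\<lambda>x t. - (\<sigma>\<^sup>2 + (2 * r - \<sigma>\<^sup>2)\<^sup>2 / (4 * r)) - 1 / t\<^sup>2) (\<lambda>x t. 2 * x) (\<lambda>x t. 2)"
    by (rule barrier_C21_on) auto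
  note phi_C21 =
    C21_on_add[OF C21_on_add[OF v_C21 C21_on_cmult[OF this, of "- \<epsilon>"]] C21_on_const[of _ "- m"],
      folded \<phi>_def]
  have phi_le: "\<phi> x t \<le> z x t" if "t \<in> {0<..<T}" for x t
    using max[OF that, of x] unfolding \<phi>_def m_def by simp
  have "\<forall>\<^sub>F p in nhds (x0, t0). p \<in> UNIV \<times> {0<..<T}"
    using t0 by (intro eventually_nhds_in_open open_Times) auto
  then have touch: "\<forall>\<^sub>F (x, t) in nhds (x0, t0). \<phi> x t \<le> z x t"
    by eventually_elim (auto intro: phi_le)
  have "\<phi> x0 t0 = z x0 t0"
    unfolding \<phi>_def m_def by simp
  then have test: "0 \<le> min (- (vt x0 t0 + (- \<epsilon>) * \<psi>t + 0)
      - bs_op r \<sigma> (\<phi> x0 t0) (vx x0 t0 + (- \<epsilon>) * (2 * x0) + 0) (vxx x0 t0 + (- \<epsilon>) * 2 + 0))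
      (z x0 t0 - put_payoff K x0)"
    using super[unfolded vi_supersolution_def, rule_format, OF phi_C21 t0 _ touch]
    unfolding \<psi>t_def by simp
  have "0 \<le> \<epsilon> * barrier r \<sigma> T x0 t0"
    using barrier_lower_bounds(1)[of r t0 T x0 \<sigma>] t0 \<open>0 < r\<close> eps
    by (intro mult_nonneg_nonneg) (auto intro: order_trans[OF zero_le_power2])
  then have "put_payoff K x0 < v x0 t0"
    using test m_pos by linarith
  note v_sub = sub[OF t0 this]
  have psi: "0 \<le> - \<psi>t - bs_op r \<sigma> (barrier r \<sigma> T x0 t0) (2 * x0) 2"
    unfolding \<psi>t_def using t0 \<open>0 < r\<close> by (intro barrier_supersolution) auto
  have "- (vt x0 t0 + (- \<epsilon>) * \<psi>t + 0)
      - bs_op r \<sigma> (\<phi> x0 t0) (vx x0 t0 + (- \<epsilon>) * (2 * x0) + 0) (vxx x0 t0 + (- \<epsilon>) * 2 + 0)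
    = (- vt x0 t0 - bs_op r \<sigma> (v x0 t0) (vx x0 t0) (vxx x0 t0))
      - \<epsilon> * (- \<psi>t - bs_op r \<sigma> (barrier r \<sigma> T x0 t0) (2 * x0) 2) - r * m"
    unfolding bs_op_def \<phi>_def by (simp add: algebra_simps diff_divide_distrib)
  also have "\<dots> < 0"
    using v_sub mult_nonneg_nonneg[OF less_imp_le[OF eps] psi]
      mult_pos_pos[OF \<open>0 < r\<close> m_pos] unfolding m_def by linarith
  finally show False
    using test by linarith
qed


section \<open>Bounds on the price of the American put\<close>

lemma (in prob_space) american_put_price_bounds:
  assumes "0 < K" and "0 < r" and "0 < S" and "t \<in> {0..T}"
  shows "0 \<le> american_put_price M F W r \<sigma> K T S t" and "american_put_price M F W r \<sigma> K T S t \<le> K"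
proof -
  define A where "A = {\<tau>. stopping_time F \<tau> \<and> (\<forall>\<omega>\<in>space M. t \<le> \<tau> \<omega> \<and> \<tau> \<omega> \<le> T)}"
  define J where
    "J \<tau> = (\<integral>\<omega>. exp (- r * (\<tau> \<omega> - t)) * max 0 (K - stock_price r \<sigma> W t S (\<tau> \<omega>) \<omega>) \<partial>M)" for \<tau>
  have price: "american_put_price M F W r \<sigma> K T S t = (SUP \<tau>\<in>A. J \<tau>)"
    unfolding american_put_price_def A_def J_def ..
  have T_in: "(\<lambda>_. T) \<in> A"
    unfolding A_def using assms(4) stopping_time_const by auto
  have J_nonneg: "0 \<le> J \<tau>" for \<tau>
    unfolding J_def by (intro integral_nonneg_AE) simp
  have J_le: "J \<tau> \<le> K" if "\<tau> \<in> A" for \<tau>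
  proof -
    let ?f = "\<lambda>\<omega>. exp (- r * (\<tau> \<omega> - t)) * max 0 (K - stock_price r \<sigma> W t S (\<tau> \<omega>) \<omega>)"
    have f_le: "?f \<omega> \<le> K" if "\<omega> \<in> space M" for \<omega>
    proof -
      have "0 \<le> stock_price r \<sigma> W t S (\<tau> \<omega>) \<omega>"
        unfolding stock_price_def using \<open>0 < S\<close> by simp
      then have "max 0 (K - stock_price r \<sigma> W t S (\<tau> \<omega>) \<omega>) \<le> K"
        using \<open>0 < K\<close> by simp
      moreover have "exp (- r * (\<tau> \<omega> - t)) \<le> 1"
        using \<open>\<tau> \<in> A\<close> that \<open>0 < r\<close> unfolding A_def by simp
      ultimately have "?f \<omega> \<le> 1 * K"
        by (intro mult_mono) auto
      then show ?thesis
        by simp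
    qed
    show ?thesis
    proof (cases "integrable M ?f")
      case True
      then show ?thesis
        unfolding J_def using f_le by (intro integral_le_const) auto
    next
      \<comment> \<open>The integral of a function that is not integrable is \<open>0\<close> by convention.\<close>
      case False
      then show ?thesis
        unfolding J_def using not_integrable_integral_eq[OF False] \<open>0 < K\<close> by simp
    qed
  qed
  show "american_put_price M F W r \<sigma> K T S t \<le> K"
    unfolding price using T_in J_le by (intro cSUP_least) auto
  have "bdd_above (J ` A)"
    using J_le by (intro bdd_aboveI[of _ K]) auto
  then show "0 \<le> american_put_price M F W r \<sigma> K T S t"
    unfolding price using cSUP_upper[OF T_in, of J] J_nonneg[of "\<lambda>_. T"] by linarith
qed


section \<open>The penalised solution and the variational inequality\<close>

lemma vi_solution_le_penalised:
  assumes "0 < r" and "0 < T" and "0 < lam"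
    and vi: "vi_solution r \<sigma> K T z" and z_le: "\<And>x t. t \<in> {0..T} \<Longrightarrow> z x t \<le> b"
    and pen: "penalised_solution r \<sigma> K T lam v"
    and above: "\<And>x t. t \<in> {0..T} \<Longrightarrow> put_payoff K x \<le> v x t + c"
    and "t \<in> {0..T}"
  shows "z x t \<le> v x t + c"
proof -
  obtain vt vx vxx where C2a: "\<And>\<alpha>. 0 < \<alpha> \<Longrightarrow> \<alpha> < 1 \<Longrightarrow> C2a_loc T \<alpha> v vt vx vxx"
    and eq: "\<And>x t. t \<in> {0..<T} \<Longrightarrow> vt x t + bs_op r \<sigma> (v x t) (vx x t) (vxx x t)
      + lam * exp (- (v x t - put_payoff K x) / lam) = 0"
    using pen unfolding penalised_solution_def by blast
  have cont: "continuous_on (UNIV \<times> {0..T}) (\<lambda>(x, t). v x t)"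
    and terminal: "\<And>x. v x T = put_payoff K x" and nonneg: "\<And>x t. t \<in> {0..T} \<Longrightarrow> 0 \<le> v x t"
    using pen unfolding penalised_solution_def by auto
  have "0 \<le> c"
    using above[of T] terminal \<open>0 < T\<close> by simp
  have "C21_on {0<..<T} v vt vx vxx"
    using C2a[of "1 / 2"] unfolding C2a_loc_def by (auto intro: C21_on_subset)
  note C21 = C21_on_add[OF this C21_on_const[of _ c]]
  show ?thesis
  proof (rule vi_subsolution_le[OF \<open>0 < r\<close> \<open>0 < T\<close> _ _ C21])
    show "vi_subsolution r \<sigma> K T z" and "continuous_on (UNIV \<times> {0..T}) (\<lambda>(x, t). z x t)"
      using vi unfolding vi_solution_def by auto
    show "continuous_on (UNIV \<times> {0..T}) (\<lambda>(x, t). v x t + c)"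
      using cont unfolding split_beta by (intro continuous_intros)
    show "z x T \<le> v x T + c" for x
      using vi terminal \<open>0 \<le> c\<close> unfolding vi_solution_def by simp
    show "z x t - (v x t + c) \<le> b" if "t \<in> {0..T}" for x t
      using z_le[OF that, of x] nonneg[OF that, of x] \<open>0 \<le> c\<close> by linarith
    show "put_payoff K x \<le> v x t + c" if "t \<in> {0<..<T}" for x t
      using above that by simp
    show "0 \<le> - (vt x t + 0) - bs_op r \<sigma> (v x t + c) (vx x t + 0) (vxx x t + 0)"
      if "t \<in> {0<..<T}" for x t
    proof -
      have "- (vt x t + 0) - bs_op r \<sigma> (v x t + c) (vx x t + 0) (vxx x t + 0)
          = lam * exp (- (v x t - put_payoff K x) / lam) + r * c"
        using eq[of t x] that unfolding bs_op_def by (simp add: algebra_simps)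
      then show ?thesis
        using \<open>0 < lam\<close> \<open>0 < r\<close> \<open>0 \<le> c\<close> by simp
    qed
  qed fact
qed

lemma penalised_le_vi_solution:
  assumes "0 < r" and "0 < T" and "0 < lam"
    and vi: "vi_solution r \<sigma> K T z" and z_ge: "\<And>x t. t \<in> {0..T} \<Longrightarrow> b \<le> z x t"
    and pen: "penalised_solution r \<sigma> K T lam v"
    and "t \<in> {0..T}"
  shows "v x t - lam * ln (1 + (T - t)) \<le> z x t"
proof -
  obtain vt vx vxx where C2a: "\<And>\<alpha>. 0 < \<alpha> \<Longrightarrow> \<alpha> < 1 \<Longrightarrow> C2a_loc T \<alpha> v vt vx vxx"
    and eq: "\<And>x t. t \<in> {0..<T} \<Longrightarrow> vt x t + bs_op r \<sigma> (v x t) (vx x t) (vxx x t)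
      + lam * exp (- (v x t - put_payoff K x) / lam) = 0"
    using pen unfolding penalised_solution_def by blast
  have cont: "continuous_on (UNIV \<times> {0..T}) (\<lambda>(x, t). v x t)"
    and terminal: "\<And>x. v x T = put_payoff K x"
    and le: "\<And>x t. t \<in> {0..T} \<Longrightarrow> v x t \<le> K + lam * (T - t)"
    using pen unfolding penalised_solution_def by auto
  have "C21_on {0<..<T} v vt vx vxx"
    using C2a[of "1 / 2"] unfolding C2a_loc_def by (auto intro: C21_on_subset)
  moreover have "C21_on {0<..<T} (\<lambda>x t. - lam * ln (1 + (T - t))) (\<lambda>x t. lam / (1 + (T - t)))
      (\<lambda>x t. 0) (\<lambda>x t. 0)"
    by (intro C21_on_time) (auto intro!: derivative_eq_intros continuous_intros)
  ultimately have C21: "C21_on {0<..<T} (\<lambda>x t. v x t + - lam * ln (1 + (T - t)))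
      (\<lambda>x t. vt x t + lam / (1 + (T - t))) (\<lambda>x t. vx x t + 0) (\<lambda>x t. vxx x t + 0)"
    by (rule C21_on_add)
  have "v x t + - lam * ln (1 + (T - t)) \<le> z x t"
  proof (rule vi_supersolution_ge[OF \<open>0 < r\<close> \<open>0 < T\<close> _ _ C21])
    show "vi_supersolution r \<sigma> K T z" and "continuous_on (UNIV \<times> {0..T}) (\<lambda>(x, t). z x t)"
      using vi unfolding vi_solution_def by auto
    show "continuous_on (UNIV \<times> {0..T}) (\<lambda>(x, t). v x t + - lam * ln (1 + (T - t)))"
      using cont unfolding split_beta by (auto intro!: continuous_intros)
    show "v x T + - lam * ln (1 + (T - T)) \<le> z x T" for x
      using vi terminal unfolding vi_solution_def by simp
    show "v x t + - lam * ln (1 + (T - t)) - z x t \<le> K + lam * T - b" if "t \<in> {0..T}" for x t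
    proof -
      have "lam * (T - t) \<le> lam * T" and "0 \<le> lam * ln (1 + (T - t))"
        using that \<open>0 < lam\<close> by simp_all
      then show ?thesis
        using le[OF that, of x] z_ge[OF that, of x] by simp
    qed
    show "- (vt x t + lam / (1 + (T - t)))
        - bs_op r \<sigma> (v x t + - lam * ln (1 + (T - t))) (vx x t + 0) (vxx x t + 0) \<le> 0"
      if t: "t \<in> {0<..<T}" and gt: "put_payoff K x < v x t + - lam * ln (1 + (T - t))" for x t
    proof -
      define l where "l = ln (1 + (T - t))"
      have "0 \<le> l"
        using t unfolding l_def by simp
      have "- (v x t - put_payoff K x) / lam \<le> - l"
        using gt \<open>0 < lam\<close> unfolding l_def by (simp add: field_simps)
      then have "exp (- (v x t - put_payoff K x) / lam) \<le> exp (- l)"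
        by simp
      also have "exp (- l) = 1 / (1 + (T - t))"
        using t unfolding l_def by (simp add: exp_minus inverse_eq_divide)
      finally have pen_le: "lam * exp (- (v x t - put_payoff K x) / lam) \<le> lam / (1 + (T - t))"
        using \<open>0 < lam\<close> mult_left_mono[of _ "1 / (1 + (T - t))" lam] by simp
      have "- (vt x t + lam / (1 + (T - t)))
          - bs_op r \<sigma> (v x t + - lam * l) (vx x t + 0) (vxx x t + 0)
        = lam * exp (- (v x t - put_payoff K x) / lam) - lam / (1 + (T - t)) - r * (lam * l)"
        using eq[of t x] t unfolding bs_op_def by (simp add: algebra_simps)
      moreover have "0 \<le> r * (lam * l)"
        using \<open>0 < r\<close> \<open>0 < lam\<close> \<open>0 \<le> l\<close> by simp
      ultimately show ?thesis
        using pen_le unfolding l_def by linarith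
    qed
  qed fact
  then show ?thesis
    by simp
qed

theorem theorem3p7:
  fixes T K r \<sigma> C :: real
    and M :: "'w measure" and F :: "real \<Rightarrow> 'w measure" and W :: "real \<Rightarrow> 'w \<Rightarrow> real"
    and u :: "real \<Rightarrow> real \<Rightarrow> real \<Rightarrow> real"
    and ustar :: "real \<Rightarrow> real \<Rightarrow> real"
    and \<Lambda> :: "real set"
  assumes "0 < T" and "0 < K" and "0 < r" and "0 < \<sigma>"
    and u_solution: "\<And>lam. 0 < lam \<Longrightarrow> penalised_solution r \<sigma> K T lam (u lam)"
    and BM: "standard_brownian_motion M F W"
    and ustar_solution: "vi_solution r \<sigma> K T ustar"
    and ustar_price: "\<And>S t. 0 < S \<Longrightarrow> t \<in> {0..T} \<Longrightarrow>
      ustar (ln S) t = american_put_price M F W r \<sigma> K T S t"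
    (* The bound below forces lam <= C * r * K (take t = T), so it cannot hold for every lam > 0 with
       one C. Hence the range of lam for which C is admissible is an arbitrary set. *)
    and "\<Lambda> \<subseteq> {0<..}" and "0 < C"
    and C_bound: "\<And>lam x t. lam \<in> \<Lambda> \<Longrightarrow> t \<in> {0..T} \<Longrightarrow>
      u lam x t \<ge> put_payoff K x - lam * ln (C * r * K / lam)"
  shows "\<forall>lam>0. \<forall>x. \<forall>t\<in>{0..T}.
    u lam x t - lam * ln (1 + (T - t)) \<le> ustar x t \<and>
    (lam \<in> \<Lambda> \<longrightarrow> ustar x t \<le> u lam x t + lam * ln (C * r * K / lam))"
proof (intro allI impI ballI conjI)
  have M: "prob_space M"
    using BM unfolding standard_brownian_motion_def by blast
  have ustar_bounds: "0 \<le> ustar x t" "ustar x t \<le> K" if "t \<in> {0..T}" for x t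
    using ustar_price[of "exp x" t] that
      prob_space.american_put_price_bounds[OF M, of K r "exp x" t T F W \<sigma>]
      \<open>0 < K\<close> \<open>0 < r\<close> by simp_all
  fix lam x t :: real
  assume "0 < lam" and t: "t \<in> {0..T}"
  note pen = u_solution[OF \<open>0 < lam\<close>]
  show "u lam x t - lam * ln (1 + (T - t)) \<le> ustar x t"
    using \<open>0 < r\<close> \<open>0 < T\<close> \<open>0 < lam\<close> ustar_solution ustar_bounds(1) pen t
    by (rule penalised_le_vi_solution)
  show "ustar x t \<le> u lam x t + lam * ln (C * r * K / lam)" if "lam \<in> \<Lambda>"
    using \<open>0 < r\<close> \<open>0 < T\<close> \<open>0 < lam\<close> ustar_solution ustar_bounds(2) pen _ t
  proof (rule vi_solution_le_penalised)
    show "put_payoff K x \<le> u lam x t + lam * ln (C * r * K / lam)" if "t \<in> {0..T}" for x t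
      using C_bound[OF \<open>lam \<in> \<Lambda>\<close> that, of x] by simp
  qed
qed

end
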